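(* Let $M$ be a rank $k$ matroid on a ground set $E$ of size $n$ with $0<k<n$, let $S=\mathbb{L}[x_e : e\in E]$ be a polynomial ring over a field $\mathbb{L}$, and let $\Delta=\Delta(M)$ be the independence complex of $M$. Then the symbolic Rees algebra $\mathcal{R}_s(I_\Delta)$ is generated as an $S$-algebra by the set of monomials \[\{x^CT^i : C \text{ a circuit of } M^{(i)},\ i\in[n-k]\}.\] Equivalently, $\mathcal{R}_s(I_\Delta)$ is generated as an $S$-algebra by \[\{x^{E\setminus F}T^{\mathrm{crk}_{M^*}(F)} : F \text{ a flat of } M^*,\ F\neq E\}.\]
   Context: $[m]=\{1,\dots,m\}$. $M^*$ is the dual matroid and $\mathcal{B}(M^* )$ its set of bases. For $r\in[n-k]$, $M^{(r)}$ is the elongation of $M$ by rank $r-1$, i.e. the matroid on $E$ (of rank $k+r-1$) whose independent sets are the subsets $A\subseteq E$ with $|A|-\mathrm{rk}_M(A)\le r-1$. For $U\subseteq E$, $x^U=\prod_{u\in U}x_u$ and $P_U=\langle x_u: u\in U\rangle$. $I_\Delta=\langle x^C : C\text{ a circuit of }M\rangle=\bigcap_{B\in\mathcal{B}(M^* )}P_B$ is the Stanley-Reisner ideal of $\Delta$; its symbolic powers are $I_\Delta^{(s)}=\bigcap_{B\in\mathcal{B}(M^* )}P_B^s$ ($I_\Delta^{(0)}=S$), and its symbolic Rees algebra is $\mathcal{R}_s(I_\Delta)=\bigoplus_{i\ge0}I_\Delta^{(i)}T^i\subseteq S[T]$. For a flat $F$ of $M^*$, $\mathrm{crk}_{M^*}(F)=\mathrm{rk}(M^*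 )-\mathrm{rk}_{M^*}(F)$. *)

theory Defs
  imports
    "HOL-Library.Poly_Mapping"
    "HOL-Algebra.UnivPoly"
    "HOL-Algebra.Ideal_Product"
    "HOL-Algebra.Generated_Rings"
begin

section \<open>Matroids\<close>

text \<open>A matroid is a finite ground set \<open>E\<close> with its family \<open>\<I>\<close> of independent sets;
  \<open>\<I>\<close> is at the same time the independence complex.\<close>

locale matroid =
  fixes E :: "'e set" and \<I> :: "'e set set"
  assumes finite_ground: "finite E"
    and indep_subset: "A \<in> \<I> \<Longrightarrow> A \<subseteq> E"
    and indep_empty: "{} \<in> \<I>"
    and indep_mono: "A \<in> \<I> \<Longrightarrow> B \<subseteq> A \<Longrightarrow> B \<in> \<I>"
    and indep_augment: "A \<in> \<I> \<Longrightarrow> B \<in> \<I> \<Longrightarrow> card A < card B \<Longrightarrow> \<exists>b\<in>B - A. insert b A \<in> \<I>"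

definition rk :: "'e set set \<Rightarrow> 'e set \<Rightarrow> nat" where
  "rk \<I> A = Max (card ` {X \<in> \<I>. X \<subseteq> A})"

definition bases :: "'e set set \<Rightarrow> 'e set set" where
  "bases \<I> = {B \<in> \<I>. \<forall>A\<in>\<I>. B \<subseteq> A \<longrightarrow> A = B}"

definition circuits :: "'e set \<Rightarrow> 'e set set \<Rightarrow> 'e set set" where
  "circuits E \<I> = {C. C \<subseteq> E \<and> C \<notin> \<I> \<and> (\<forall>D. D \<subset> C \<longrightarrow> D \<in> \<I>)}"

definition flats :: "'e set \<Rightarrow> 'e set set \<Rightarrow> 'e set set" where
  "flats E \<I> = {F. F \<subseteq> E \<and> (\<forall>e\<in>E - F. rk \<I> F < rk \<I> (insert e F))}"

definition crk :: "'e set \<Rightarrow> 'e set set \<Rightarrow> 'e set \<Rightarrow> nat" where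
  "crk E \<I> F = rk \<I> E - rk \<I> F"

text \<open>Independent sets of the dual: the sets avoiding some basis, so that the bases of the dual
  are the complements of the bases.\<close>

definition dual :: "'e set \<Rightarrow> 'e set set \<Rightarrow> 'e set set" where
  "dual E \<I> = {A. A \<subseteq> E \<and> (\<exists>B\<in>bases \<I>. A \<inter> B = {})}"

definition elongation :: "'e set \<Rightarrow> 'e set set \<Rightarrow> nat \<Rightarrow> 'e set set" where
  "elongation E \<I> r = {A. A \<subseteq> E \<and> int (card A) - int (rk \<I> A) \<le> int r - 1}"


section \<open>The polynomial ring over a field in the variables indexed by a set\<close>

text \<open>\<open>'e \<Rightarrow>\<^sub>0 nat\<close> is the type of exponent vectors, so \<open>('e \<Rightarrow>\<^sub>0 nat) \<Rightarrow>\<^sub>0 'l\<close>, with the convolution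
  product of the library, is the polynomial ring in all variables indexed by \<open>'e\<close>;
  the carrier keeps the polynomials in the variables from \<open>E\<close>.\<close>

type_synonym ('e, 'l) mpoly = "('e \<Rightarrow>\<^sub>0 nat) \<Rightarrow>\<^sub>0 'l"

definition mpoly_ring :: "'e set \<Rightarrow> ('e, 'l::field) mpoly ring" where
  "mpoly_ring E = \<lparr> carrier = {p. \<forall>m\<in>Poly_Mapping.keys p. Poly_Mapping.keys m \<subseteq> E},
     mult = (*), one = 1, zero = 0, add = (+) \<rparr>"

definition xvar :: "'e \<Rightarrow> ('e, 'l::field) mpoly" where
  "xvar e = Poly_Mapping.single (Poly_Mapping.single e 1) 1"

definition xset :: "'e set \<Rightarrow> ('e, 'l::field) mpoly" where
  "xset U = (\<Prod>u\<in>U. xvar u)"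

definition var_ideal :: "'e set \<Rightarrow> 'e set \<Rightarrow> ('e, 'l::field) mpoly set" where
  "var_ideal E U = genideal (mpoly_ring E) (xvar ` U)"

definition stanley_reisner_ideal :: "'e set \<Rightarrow> 'e set set \<Rightarrow> ('e, 'l::field) mpoly set" where
  "stanley_reisner_ideal E \<I> = genideal (mpoly_ring E) (xset ` circuits E \<I>)"

text \<open>The \<open>s\<close>-th symbolic power of the Stanley-Reisner ideal of the matroid. Powers of ideals are
  taken in the multiplicative monoid of all ideals, so the 0-th power is the whole ring.
  By \<open>symbolic_power_1\<close> below, the first symbolic power is the
  Stanley-Reisner ideal itself.\<close>

definition symbolic_power :: "'e set \<Rightarrow> 'e set set \<Rightarrow> nat \<Rightarrow> ('e, 'l::field) mpoly set" where
  "symbolic_power E \<I> s =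
     (\<Inter>B\<in>bases (dual E \<I>). var_ideal E B [^]\<^bsub>ideals_set (mpoly_ring E)\<^esub> s)"


section \<open>Symbolic Rees algebra\<close>

definition symbolic_rees :: "'e set \<Rightarrow> 'e set set \<Rightarrow> (nat \<Rightarrow> ('e, 'l::field) mpoly) set" where
  "symbolic_rees E \<I> =
     {p \<in> carrier (UP (mpoly_ring E)). \<forall>i. coeff (UP (mpoly_ring E)) p i \<in> symbolic_power E \<I> i}"

text \<open>The \<open>S\<close>-subalgebra of \<open>S[T]\<close> generated by \<open>G\<close>: the subring generated by the constants
  and \<open>G\<close>.\<close>

definition generated_algebra :: "('a, 'b) ring_scheme \<Rightarrow> (nat \<Rightarrow> 'a) set \<Rightarrow> (nat \<Rightarrow> 'a) set" where
  "generated_algebra S G = generate_ring (UP S) ((\<lambda>a. monom (UP S) a 0) ` carrier S \<union> G)"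

section \<open>The first symbolic power\<close>

lemma keys_uminus: "Poly_Mapping.keys (- p) = Poly_Mapping.keys (p :: 'a \<Rightarrow>\<^sub>0 'b::ab_group_add)"
  by (auto simp: in_keys_iff)

lemma keys_add_exponent:
  "Poly_Mapping.keys (a + b) = Poly_Mapping.keys a \<union> Poly_Mapping.keys (b :: 'a \<Rightarrow>\<^sub>0 nat)"
  by (auto simp: in_keys_iff lookup_add)

lemma mpoly_ring_cring: "cring (mpoly_ring E :: ('e, 'l::field) mpoly ring)"
proof -
  let ?S = "mpoly_ring E :: ('e, 'l) mpoly ring"
  have add: "x + y \<in> carrier ?S" if "x \<in> carrier ?S" "y \<in> carrier ?S" for x y
    using that keys_add[of x y] by (auto simp: mpoly_ring_def)
  have neg: "- x \<in> carrier ?S" if "x \<in> carrier ?S" for x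
    using that by (simp add: mpoly_ring_def keys_uminus)
  have mult: "x * y \<in> carrier ?S" if "x \<in> carrier ?S" "y \<in> carrier ?S" for x y
  proof -
    have "Poly_Mapping.keys m \<subseteq> E" if m: "m \<in> Poly_Mapping.keys (x * y)" for m
    proof -
      obtain a b where "m = a + b" "a \<in> Poly_Mapping.keys x" "b \<in> Poly_Mapping.keys y"
        using subsetD[OF keys_mult m] by blast
      with \<open>x \<in> carrier ?S\<close> \<open>y \<in> carrier ?S\<close> show ?thesis
        by (simp add: keys_add_exponent mpoly_ring_def)
    qed
    then show ?thesis by (simp add: mpoly_ring_def)
  qed
  have ops: "x \<oplus>\<^bsub>?S\<^esub> y = x + y" "x \<otimes>\<^bsub>?S\<^esub> y = x * y" "\<zero>\<^bsub>?S\<^esub> = 0" "\<one>\<^bsub>?S\<^esub> = 1" for x y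
    by (simp_all add: mpoly_ring_def)
  have zero: "0 \<in> carrier ?S" and one: "1 \<in> carrier ?S" by (simp_all add: mpoly_ring_def)
  have "abelian_group ?S"
  proof (rule abelian_groupI)
    fix x assume "x \<in> carrier ?S"
    then show "\<exists>y\<in>carrier ?S. y \<oplus>\<^bsub>?S\<^esub> x = \<zero>\<^bsub>?S\<^esub>"
      using neg by (intro bexI[of _ "- x"]) (simp_all add: ops)
  qed (simp_all add: ops add zero ac_simps)
  moreover have "comm_monoid ?S"
    by (rule comm_monoidI) (simp_all add: ops mult one ac_simps)
  ultimately show ?thesis by (rule cringI) (simp add: ops distrib_right)
qed

lemma xset_eq_single:
  assumes "finite U"
  shows "(xset U :: ('e, 'l::field) mpoly) =
           Poly_Mapping.single (\<Sum>u\<in>U. Poly_Mapping.single u 1) 1"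
  using assms by (induction U) (simp_all add: xset_def xvar_def mult_single)

lemma lookup_sum_single:
  assumes "finite U"
  shows "Poly_Mapping.lookup (\<Sum>u\<in>U. Poly_Mapping.single u (1::nat)) e = (if e \<in> U then 1 else 0)"
  using assms by (induction U) (auto simp: lookup_add lookup_single when_def)

lemma single_split:
  assumes "finite A" and "A \<subseteq> Poly_Mapping.keys m"
  shows "Poly_Mapping.single m (c::'l::field)
           = Poly_Mapping.single (m - (\<Sum>u\<in>A. Poly_Mapping.single u 1)) c * xset A"
proof -
  have "m - (\<Sum>u\<in>A. Poly_Mapping.single u 1) + (\<Sum>u\<in>A. Poly_Mapping.single u 1) = m"
  proof (rule poly_mapping_eqI)
    fix e
    show "Poly_Mapping.lookup (m - (\<Sum>u\<in>A. Poly_Mapping.single u 1) + (\<Sum>u\<in>A. Poly_Mapping.single u 1)) e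
            = Poly_Mapping.lookup m e"
      using assms(2)
      by (cases "e \<in> A")
        (auto simp: lookup_add lookup_minus lookup_sum_single[OF assms(1)] in_keys_iff
          simp del: One_nat_def)
  qed
  then show ?thesis by (simp add: xset_eq_single[OF assms(1)] mult_single)
qed

lemma mpoly_sum_singles:
  "(p :: ('e, 'l::field) mpoly) = (\<Sum>m\<in>Poly_Mapping.keys p. Poly_Mapping.single m (Poly_Mapping.lookup p m))"
proof (rule poly_mapping_eqI)
  fix k
  show "Poly_Mapping.lookup p k = Poly_Mapping.lookup (\<Sum>m\<in>Poly_Mapping.keys p. Poly_Mapping.single m (Poly_Mapping.lookup p m)) k"
    by (cases "k \<in> Poly_Mapping.keys p")
      (auto simp: lookup_sum lookup_single when_def in_keys_iff sum.delta)
qed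

lemma squarefree_ideal_eq:
  assumes "finite E" and AE: "\<And>A. A \<in> \<A> \<Longrightarrow> A \<subseteq> E"
  shows "genideal (mpoly_ring E) (xset ` \<A> :: ('e, 'l::field) mpoly set) =
    {p \<in> carrier (mpoly_ring E). \<forall>m\<in>Poly_Mapping.keys p. \<exists>A\<in>\<A>. A \<subseteq> Poly_Mapping.keys m}"
    (is "?I = ?J")
proof -
  interpret S: cring "mpoly_ring E :: ('e, 'l) mpoly ring" by (rule mpoly_ring_cring)
  have finA: "finite A" if "A \<in> \<A>" for A using AE[OF that] assms(1) by (rule finite_subset)
  have keysA: "Poly_Mapping.keys (\<Sum>u\<in>A. Poly_Mapping.single u (1::nat)) = A" if "A \<in> \<A>" for A
    using lookup_sum_single[OF finA[OF that]] by (auto simp: in_keys_iff simp del: One_nat_def split: if_splits)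
  have gens: "xset ` \<A> \<subseteq> ?J"
    by (auto simp: mpoly_ring_def xset_eq_single finA keysA simp del: One_nat_def dest: subsetD[OF AE])
  have "ideal ?J (mpoly_ring E)"
  proof (rule idealI)
    show "ring (mpoly_ring E :: ('e, 'l) mpoly ring)" by (rule S.ring_axioms)
    show "subgroup ?J (add_monoid (mpoly_ring E))"
    proof (rule S.add.subgroupI)
      have "0 \<in> ?J" by (simp add: mpoly_ring_def)
      then show "?J \<noteq> {}" by blast
    next
      fix a assume a: "a \<in> ?J"
      have "\<ominus>\<^bsub>mpoly_ring E\<^esub> a = - a"
      proof (rule S.minus_equality)
        show "- a \<oplus>\<^bsub>mpoly_ring E\<^esub> a = \<zero>\<^bsub>mpoly_ring E\<^esub>" by (simp add: mpoly_ring_def)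
      qed (use a in \<open>auto simp: mpoly_ring_def keys_uminus\<close>)
      with a show "\<ominus>\<^bsub>mpoly_ring E\<^esub> a \<in> ?J" by (simp add: mpoly_ring_def keys_uminus)
    next
      fix a b assume "a \<in> ?J" "b \<in> ?J"
      then show "a \<oplus>\<^bsub>mpoly_ring E\<^esub> b \<in> ?J"
        using keys_add[of a b] S.add.m_closed[of a b] by (auto simp: mpoly_ring_def)
    qed auto
    have l: "x \<otimes>\<^bsub>mpoly_ring E\<^esub> a \<in> ?J" if a: "a \<in> ?J" and x: "x \<in> carrier (mpoly_ring E)" for a x
    proof -
      have "\<exists>A\<in>\<A>. A \<subseteq> Poly_Mapping.keys m" if m: "m \<in> Poly_Mapping.keys (x * a)" for m
      proof -
        obtain u v where "m = u + v" "v \<in> Poly_Mapping.keys a"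
          using subsetD[OF keys_mult m] by blast
        moreover then obtain A where "A \<in> \<A>" "A \<subseteq> Poly_Mapping.keys v" using a by blast
        ultimately show ?thesis using keys_add_exponent[of u v] by blast
      qed
      then show ?thesis using S.m_closed[of x a] a x by (simp add: mpoly_ring_def)
    qed
    then show "x \<otimes>\<^bsub>mpoly_ring E\<^esub> a \<in> ?J" if "a \<in> ?J" "x \<in> carrier (mpoly_ring E)" for a x
      using that by blast
    show "a \<otimes>\<^bsub>mpoly_ring E\<^esub> x \<in> ?J" if "a \<in> ?J" "x \<in> carrier (mpoly_ring E)" for a x
      using l[OF that] that S.m_comm[of a x] by auto
  qed
  then have "?I \<subseteq> ?J" using gens by (rule S.genideal_minimal)
  moreover have "?J \<subseteq> ?I"
  proof
    fix p assume p: "p \<in> ?J"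
    interpret I: ideal ?I "mpoly_ring E :: ('e, 'l) mpoly ring"
      by (rule S.genideal_ideal) (use gens in blast)
    have mono: "Poly_Mapping.single m (Poly_Mapping.lookup p m) \<in> ?I" if m: "m \<in> Poly_Mapping.keys p" for m
    proof -
      obtain A where A: "A \<in> \<A>" "A \<subseteq> Poly_Mapping.keys m" using p m by blast
      let ?q = "Poly_Mapping.single (m - (\<Sum>u\<in>A. Poly_Mapping.single u 1)) (Poly_Mapping.lookup p m)"
      have "Poly_Mapping.keys (m - (\<Sum>u\<in>A. Poly_Mapping.single u 1)) \<subseteq> Poly_Mapping.keys m"
        by (auto simp: in_keys_iff lookup_minus)
      then have "?q \<in> carrier (mpoly_ring E)" using p m by (auto simp: mpoly_ring_def)
      moreover have "xset A \<in> ?I" using S.genideal_self[of "xset ` \<A>"] gens A(1) by blast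
      ultimately have "?q \<otimes>\<^bsub>mpoly_ring E\<^esub> xset A \<in> ?I" by (intro I.I_l_closed)
      then show ?thesis by (simp add: single_split[OF finA[OF A(1)] A(2)] mpoly_ring_def)
    qed
    have "(\<Sum>m\<in>K. Poly_Mapping.single m (Poly_Mapping.lookup p m)) \<in> ?I"
      if "finite K" "K \<subseteq> Poly_Mapping.keys p" for K
      using that
    proof (induction K)
      case empty
      then show ?case using I.zero_closed by (simp add: mpoly_ring_def)
    next
      case (insert m K)
      then show ?case using I.a_closed[OF mono[of m]] by (simp add: mpoly_ring_def)
    qed
    then show "p \<in> ?I" using mpoly_sum_singles[of p] by (metis finite_keys order_refl)
  qed
  ultimately show ?thesis by blast
qed

lemma (in matroid) basis_superset:
  assumes "A \<in> \<I>"
  obtains B where "B \<in> bases \<I>" "A \<subseteq> B"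
proof -
  have "finite \<I>" using finite_ground indep_subset by (meson Pow_iff finite_Pow_iff finite_subset subsetI)
  then obtain B where "B \<in> \<I>" "A \<subseteq> B" "\<forall>C\<in>\<I>. B \<subseteq> C \<longrightarrow> B = C"
    using finite_has_maximal2[OF _ assms] by blast
  then have "B \<in> bases \<I>" unfolding bases_def by blast
  then show ?thesis using that \<open>A \<subseteq> B\<close> by blast
qed

lemma (in matroid) basis_card:
  assumes "A \<in> bases \<I>" "B \<in> bases \<I>"
  shows "card A = card B"
proof -
  have "\<not> card X < card Y" if "X \<in> bases \<I>" "Y \<in> bases \<I>" for X Y
    using indep_augment[of X Y] that by (auto simp: bases_def)
  then show ?thesis using assms by (meson linorder_neqE_nat)
qed

lemma (in matroid) bases_dual: "bases (dual E \<I>) = (\<lambda>B. E - B) ` bases \<I>"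
proof -
  have sub: "B \<subseteq> E" if "B \<in> bases \<I>" for B using that indep_subset by (auto simp: bases_def)
  have in_dual: "E - B \<in> dual E \<I>" if "B \<in> bases \<I>" for B using that by (auto simp: dual_def)
  have le: "\<exists>B\<in>bases \<I>. A \<subseteq> E - B" if "A \<in> dual E \<I>" for A using that by (auto simp: dual_def)
  show ?thesis
  proof (intro equalityI subsetI)
    fix A assume A: "A \<in> bases (dual E \<I>)"
    then have "A \<in> dual E \<I>" by (simp add: bases_def)
    then obtain B where "B \<in> bases \<I>" "A \<subseteq> E - B" using le by blast
    moreover from this have "E - B = A" using A in_dual[of B] by (simp add: bases_def)
    ultimately show "A \<in> (\<lambda>B. E - B) ` bases \<I>" by blast
  next
    fix A assume "A \<in> (\<lambda>B. E - B) ` bases \<I>"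
    then obtain B where B: "B \<in> bases \<I>" "A = E - B" by blast
    have "C = A" if C: "C \<in> dual E \<I>" "A \<subseteq> C" for C
    proof -
      obtain B' where B': "B' \<in> bases \<I>" "C \<subseteq> E - B'" using le C(1) by blast
      have "B' \<subseteq> B" using B B' C(2) sub by blast
      then have "B' = B"
        using basis_card[OF B(1) B'(1)] finite_subset[OF sub[OF B(1)] finite_ground]
        by (simp add: card_subset_eq)
      then show ?thesis using B B' C by blast
    qed
    then show "A \<in> bases (dual E \<I>)" using in_dual[OF B(1)] B(2) by (auto simp: bases_def)
  qed
qed

lemma (in matroid) circuit_subset:
  assumes "U \<subseteq> E" "U \<notin> \<I>"
  obtains C where "C \<in> circuits E \<I>" "C \<subseteq> U"
proof -
  have "finite {D. D \<subseteq> U \<and> D \<notin> \<I>}" using assms(1) finite_ground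
    by (auto intro: finite_subset[of _ "Pow E"])
  then obtain C where C: "C \<subseteq> U" "C \<notin> \<I>" "\<forall>D\<in>{D. D \<subseteq> U \<and> D \<notin> \<I>}. D \<subseteq> C \<longrightarrow> C = D"
    using finite_has_minimal2[of "{D. D \<subseteq> U \<and> D \<notin> \<I>}" U] assms by blast
  then have "C \<in> circuits E \<I>" using assms(1) unfolding circuits_def by blast
  then show ?thesis using that C by blast
qed

theorem (in matroid) symbolic_power_1:
  "symbolic_power E \<I> 1 = (stanley_reisner_ideal E \<I> :: ('e, 'l::field) mpoly set)"
proof -
  let ?S = "mpoly_ring E :: ('e, 'l) mpoly ring"
  interpret S: cring ?S by (rule mpoly_ring_cring)
  interpret M: comm_monoid "ideals_set ?S" by (rule S.ideals_set_is_comm_monoid)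
  have V: "var_ideal E U = {p \<in> carrier ?S. \<forall>m\<in>Poly_Mapping.keys p. Poly_Mapping.keys m \<inter> U \<noteq> {}}"
    and P: "var_ideal E U [^]\<^bsub>ideals_set ?S\<^esub> (1::nat) = var_ideal E U" if U: "U \<subseteq> E" for U
  proof -
    have x: "xvar ` U = (xset ` (\<lambda>u. {u}) ` U :: ('e, 'l) mpoly set)"
      by (simp add: image_image xset_def)
    show *: "var_ideal E U = {p \<in> carrier ?S. \<forall>m\<in>Poly_Mapping.keys p. Poly_Mapping.keys m \<inter> U \<noteq> {}}"
      unfolding var_ideal_def x by (subst squarefree_ideal_eq[OF finite_ground]) (use U in blast)+
    have "xvar ` U \<subseteq> carrier ?S" using U by (auto simp: mpoly_ring_def xvar_def)
    then have "ideal (var_ideal E U) ?S" unfolding var_ideal_def by (rule S.genideal_ideal)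
    then have "var_ideal E U \<in> carrier (ideals_set ?S)" by (simp add: ideals_set_def)
    then show "var_ideal E U [^]\<^bsub>ideals_set ?S\<^esub> (1::nat) = var_ideal E U" by (rule M.nat_pow_eone)
  qed
  have ne: "bases \<I> \<noteq> {}" using basis_superset[OF indep_empty] by blast
  have eq: "(\<forall>B\<in>bases \<I>. U \<inter> (E - B) \<noteq> {}) \<longleftrightarrow> (\<exists>C\<in>circuits E \<I>. C \<subseteq> U)" if U: "U \<subseteq> E" for U
  proof
    assume *: "\<forall>B\<in>bases \<I>. U \<inter> (E - B) \<noteq> {}"
    have "U \<notin> \<I>"
    proof
      assume "U \<in> \<I>"
      then obtain B where "B \<in> bases \<I>" "U \<subseteq> B" by (rule basis_superset)
      with * show False by blast
    qed
    then obtain C where "C \<in> circuits E \<I>" "C \<subseteq> U" by (rule circuit_subset[OF U])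
    then show "\<exists>C\<in>circuits E \<I>. C \<subseteq> U" by blast
  next
    assume "\<exists>C\<in>circuits E \<I>. C \<subseteq> U"
    then obtain C where "C \<notin> \<I>" "C \<subseteq> U" by (auto simp: circuits_def)
    have "U \<inter> (E - B) \<noteq> {}" if "B \<in> bases \<I>" for B
    proof
      assume "U \<inter> (E - B) = {}"
      then have "C \<subseteq> B" using U \<open>C \<subseteq> U\<close> by blast
      moreover have "B \<in> \<I>" using that by (simp add: bases_def)
      ultimately show False using indep_mono \<open>C \<notin> \<I>\<close> by blast
    qed
    then show "\<forall>B\<in>bases \<I>. U \<inter> (E - B) \<noteq> {}" by blast
  qed
  have "symbolic_power E \<I> 1 = (\<Inter>B\<in>bases \<I>. var_ideal E (E - B) :: ('e, 'l) mpoly set)"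
    unfolding symbolic_power_def bases_dual image_image by (intro INF_cong refl P) blast
  also have "\<dots> = {p \<in> carrier ?S. \<forall>m\<in>Poly_Mapping.keys p. \<forall>B\<in>bases \<I>. Poly_Mapping.keys m \<inter> (E - B) \<noteq> {}}"
    using ne by (auto simp: V)
  also have "\<dots> = {p \<in> carrier ?S. \<forall>m\<in>Poly_Mapping.keys p. \<exists>C\<in>circuits E \<I>. C \<subseteq> Poly_Mapping.keys m}"
  proof (intro Collect_cong conj_cong ball_cong refl)
    fix p m assume "p \<in> carrier ?S" "m \<in> Poly_Mapping.keys p"
    then have "Poly_Mapping.keys m \<subseteq> E" by (simp add: mpoly_ring_def)
    then show "(\<forall>B\<in>bases \<I>. Poly_Mapping.keys m \<inter> (E - B) \<noteq> {})
                 \<longleftrightarrow> (\<exists>C\<in>circuits E \<I>. C \<subseteq> Poly_Mapping.keys m)"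
      by (rule eq)
  qed
  also have "\<dots> = stanley_reisner_ideal E \<I>"
    unfolding stanley_reisner_ideal_def
    by (subst squarefree_ideal_eq[OF finite_ground]) (simp_all add: circuits_def)
  finally show ?thesis .
qed

end

theory Submission
  imports Defs
begin

text \<open>Write \<open>\<nu>(A) = |A| - rk(A)\<close> for the nullity. The independent sets of the \<open>i\<close>-th elongation are the
  sets with \<open>\<nu> < i\<close>, and \<open>\<nu>(E - F)\<close> is the corank of \<open>F\<close> in the dual; as \<open>\<nu>\<close> grows by at most one when
  an element is added, a circuit of the \<open>i\<close>-th elongation is exactly the complement of a flat of corank
  \<open>i\<close>, so the two generating sets coincide. A monomial \<open>x\<^sup>m\<close> lies in the \<open>s\<close>-th symbolic power iff
  \<open>m\<close> has weight at least \<open>s\<close> on the complement of every basis. By the greedy principle some basis is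
  optimal for all level sets \<open>L\<^sub>t = {e. t < m e}\<close> at once, and on its complement the weight of \<open>m\<close> is
  \<open>\<Sum>\<^sub>t \<nu>(L\<^sub>t)\<close>. Hence \<open>x\<^sup>m T\<^sup>s\<close> factors into terms \<open>x\<^bsup>L\<^sub>t\<^esup> T\<^sup>j\<close> with \<open>j \<le> \<nu>(L\<^sub>t)\<close>, and such an \<open>L\<^sub>t\<close>
  contains a circuit of the \<open>j\<close>-th elongation.\<close>

section \<open>Nullity\<close>

text \<open>The truncated subtraction is exact on subsets of the ground set by
  \<open>rk_le_card\<close>; \<open>nullity_add_rk\<close> gives the additive form used in
  arithmetic.\<close>

definition nullity :: "'e set set \<Rightarrow> 'e set \<Rightarrow> nat" where
  "nullity \<I> A = card A - rk \<I> A"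

context matroid
begin

lemma finite_subset_ground: "A \<subseteq> E \<Longrightarrow> finite A"
  using finite_ground by (rule rev_finite_subset)

lemma finite_indep: "finite \<I>"
  using finite_ground indep_subset by (auto intro: finite_subset[of _ "Pow E"])

lemma rk_ge: "X \<in> \<I> \<Longrightarrow> X \<subseteq> A \<Longrightarrow> card X \<le> rk \<I> A"
  unfolding rk_def using finite_indep by (intro Max_ge) auto

lemma rk_witness:
  obtains X where "X \<in> \<I>" "X \<subseteq> A" "card X = rk \<I> A"
proof -
  have "rk \<I> A \<in> card ` {X \<in> \<I>. X \<subseteq> A}"
    unfolding rk_def using finite_indep indep_empty by (intro Max_in) auto
  then show ?thesis using that by auto
qed

lemma rk_le_card:
  assumes "A \<subseteq> E"
  shows "rk \<I> A \<le> card A"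
proof -
  obtain X where "X \<subseteq> A" "card X = rk \<I> A" by (rule rk_witness)
  then show ?thesis using card_mono[OF finite_subset_ground[OF assms], of X] by simp
qed

lemma rk_mono:
  assumes "A \<subseteq> B"
  shows "rk \<I> A \<le> rk \<I> B"
proof -
  obtain X where "X \<in> \<I>" "X \<subseteq> A" "card X = rk \<I> A" by (rule rk_witness)
  then show ?thesis using rk_ge[of X B] assms by simp
qed

lemma nullity_add_rk: "A \<subseteq> E \<Longrightarrow> nullity \<I> A + rk \<I> A = card A"
  using rk_le_card by (simp add: nullity_def)

text \<open>A largest independent \<open>X\<close> in \<open>B\<close> splits into
  \<open>X \<inter> A\<close>, of size at most the rank of \<open>A\<close>, and
  \<open>X - A\<close>, of size at most that of \<open>B - A\<close>. So the rank grows no faster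
  than the cardinality.\<close>

lemma nullity_mono:
  assumes "A \<subseteq> B" "B \<subseteq> E"
  shows "nullity \<I> A \<le> nullity \<I> B"
proof -
  obtain X where X: "X \<in> \<I>" "X \<subseteq> B" "card X = rk \<I> B" by (rule rk_witness)
  have fin: "finite A" "finite B" using assms finite_subset_ground by auto
  have "card X = card (X \<inter> A) + card (X - A)"
    using finite_subset[OF X(2) fin(2)] by (simp add: card_Diff_subset_Int card_mono)
  moreover have "card (X \<inter> A) \<le> rk \<I> A" using X(1) by (intro rk_ge) (auto intro: indep_mono)
  moreover have "card (X - A) \<le> card (B - A)" using X(2) fin by (intro card_mono) auto
  moreover have "card (B - A) + card A = card B"
    using assms(1) fin by (simp add: card_Diff_subset card_mono)
  ultimately show ?thesis
    using nullity_add_rk[OF subset_trans[OF assms]] nullity_add_rk[OF assms(2)] X(3) by linarith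
qed

text \<open>The cardinality grows by at most one while the rank does not drop.\<close>

lemma nullity_insert_le:
  assumes "insert e A \<subseteq> E"
  shows "nullity \<I> (insert e A) \<le> Suc (nullity \<I> A)"
proof -
  have "A \<subseteq> E" using assms by blast
  moreover have "card (insert e A) \<le> Suc (card A)" using finite_subset_ground[OF \<open>A \<subseteq> E\<close>] by (simp add: card_insert_if)
  ultimately show ?thesis
    using rk_mono[OF subset_insertI, of A e] nullity_add_rk[of A] nullity_add_rk[OF assms] by linarith
qed

lemma nullity_empty: "nullity \<I> {} = 0"
  by (simp add: nullity_def)

section \<open>Extending independent sets, and bases optimal along a chain\<close>

text \<open>An inclusion-maximal independent set between \<open>X\<close> and \<open>A\<close>
  reaches the rank of \<open>A\<close>, since otherwise augmentation from an independent set of that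
  size would enlarge it.\<close>

lemma indep_extend:
  assumes "X \<in> \<I>" "X \<subseteq> A"
  obtains Y where "Y \<in> \<I>" "X \<subseteq> Y" "Y \<subseteq> A" "card Y = rk \<I> A"
proof -
  have "finite {Y \<in> \<I>. Y \<subseteq> A}" using finite_indep by simp
  then obtain Y where Y: "Y \<in> \<I>" "Y \<subseteq> A" "X \<subseteq> Y"
    and max: "\<forall>Z\<in>{Y \<in> \<I>. Y \<subseteq> A}. Y \<subseteq> Z \<longrightarrow> Y = Z"
    using finite_has_maximal2[of "{Y \<in> \<I>. Y \<subseteq> A}" X] assms by auto
  obtain Z where Z: "Z \<in> \<I>" "Z \<subseteq> A" "card Z = rk \<I> A" by (rule rk_witness)
  have "\<not> card Y < card Z"
  proof
    assume "card Y < card Z"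
    then obtain z where "z \<in> Z - Y" "insert z Y \<in> \<I>" using indep_augment Y(1) Z(1) by blast
    then show False using max Y(2) Z(2) by blast
  qed
  then have "card Y = rk \<I> A" using rk_ge[OF Y(1,2)] Z(3) by simp
  then show ?thesis using that Y by blast
qed

lemma card_bases:
  assumes "B \<in> bases \<I>"
  shows "card B = rk \<I> E"
proof -
  have B: "B \<in> \<I>" "\<And>A. A \<in> \<I> \<Longrightarrow> B \<subseteq> A \<Longrightarrow> A = B" using assms by (auto simp: bases_def)
  obtain Y where "Y \<in> \<I>" "B \<subseteq> Y" "card Y = rk \<I> E"
    using indep_extend[OF B(1) indep_subset[OF B(1)]] by blast
  then show ?thesis using B(2) by blast
qed

lemma bases_subset_ground: "B \<in> bases \<I> \<Longrightarrow> B \<subseteq> E"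
  by (auto simp: bases_def dest: indep_subset)

lemma indep_Int_basis: "B \<in> bases \<I> \<Longrightarrow> B \<inter> A \<in> \<I>"
  by (auto simp: bases_def intro: indep_mono)

text \<open>The greedy principle: start in the smallest set of the chain, extend inside each larger
  one, and finally complete to a basis. Optimality reached in a smaller set survives every
  extension.\<close>

lemma chain_basis:
  fixes L :: "nat \<Rightarrow> 'e set"
  assumes "antimono L"
  obtains B where "B \<in> bases \<I>" "\<And>t. t < N \<Longrightarrow> card (B \<inter> L t) = rk \<I> (L t)"
proof -
  \<comment> \<open>One set more than required is covered, so that the induction starts from a
    single set. The conjunct \<open>X \<subseteq> L 0\<close> allows the extension inside the next
    larger set.\<close>
  have "\<exists>X\<in>\<I>. X \<subseteq> L 0 \<and> (\<forall>t<Suc N. card (X \<inter> L t) = rk \<I> (L t))" if "antimono L" for L :: "nat \<Rightarrow> 'e set"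
    using that
  proof (induction N arbitrary: L)
    case 0
    obtain X where "X \<in> \<I>" "X \<subseteq> L 0" "card X = rk \<I> (L 0)" by (rule rk_witness)
    then show ?case by (intro bexI[of _ X]) (auto simp: Int_absorb2)
  next
    case (Suc N)
    have "antimono (\<lambda>t. L (Suc t))" using Suc.prems by (simp add: antimono_def)
    then obtain X where X: "X \<in> \<I>" "X \<subseteq> L (Suc 0)"
      "\<And>t. t < Suc N \<Longrightarrow> card (X \<inter> L (Suc t)) = rk \<I> (L (Suc t))"
      using Suc.IH[of "\<lambda>t. L (Suc t)"] by auto
    have "X \<subseteq> L 0" using X(2) antimonoD[OF Suc.prems, of 0 "Suc 0"] by auto
    then obtain Y where Y: "Y \<in> \<I>" "X \<subseteq> Y" "Y \<subseteq> L 0" "card Y = rk \<I> (L 0)"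
      using indep_extend[OF X(1)] by blast
    have "card (Y \<inter> L t) = rk \<I> (L t)" if t: "t < Suc (Suc N)" for t
    proof (cases t)
      case 0
      then show ?thesis using Y by (simp add: Int_absorb2)
    next
      case (Suc u)
      \<comment> \<open>\<open>X\<close> already attains the rank on this level, and the independent
        set \<open>Y\<close> above it cannot exceed the rank.\<close>
      have "card (X \<inter> L t) \<le> card (Y \<inter> L t)"
        using Y(1,2) indep_subset finite_subset_ground by (intro card_mono) auto
      moreover have "card (Y \<inter> L t) \<le> rk \<I> (L t)"
        using Y(1) by (intro rk_ge) (auto intro: indep_mono)
      ultimately show ?thesis using X(3)[of u] t Suc by simp
    qed
    then show ?case using Y by blast
  qed
  from this[OF assms] obtain X where X: "X \<in> \<I>" "\<And>t. t < Suc N \<Longrightarrow> card (X \<inter> L t) = rk \<I> (L t)"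
    by blast
  obtain B where B: "B \<in> bases \<I>" "X \<subseteq> B" using basis_superset[OF X(1)] by blast
  have "card (B \<inter> L t) = rk \<I> (L t)" if "t < N" for t
  proof (rule antisym)
    show "card (B \<inter> L t) \<le> rk \<I> (L t)" by (intro rk_ge indep_Int_basis B) auto
    have "card (X \<inter> L t) \<le> card (B \<inter> L t)"
      using B finite_subset_ground bases_subset_ground by (intro card_mono) auto
    then show "rk \<I> (L t) \<le> card (B \<inter> L t)" using X(2)[of t] that by simp
  qed
  then show ?thesis using that B(1) by blast
qed

lemma card_Diff_plus_Int:
  assumes "A \<subseteq> E"
  shows "card (A - B) + card (B \<inter> A) = card A"
  using finite_subset_ground[OF assms]
  by (simp add: card_Diff_subset_Int card_mono Int_commute)

text \<open>\<open>B \<inter> A\<close> is independent, so it has at most \<open>rk \<I> A\<close>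
  elements. The bound places \<open>xset A\<close> in symbolic powers.\<close>

lemma nullity_le_card_Diff_basis:
  assumes "A \<subseteq> E" "B \<in> bases \<I>"
  shows "nullity \<I> A \<le> card (A - B)"
  using nullity_add_rk[OF assms(1)] card_Diff_plus_Int[OF assms(1), of B]
    rk_ge[OF indep_Int_basis[OF assms(2)], of A A] by simp

section \<open>Rank, corank and flats of the dual\<close>

text \<open>This is the classical dual rank formula \<open>|F| + rk(E - F) - rk(E)\<close> in
  additive form: a largest dual independent subset of \<open>F\<close> is \<open>F - B\<close> for a
  basis \<open>B\<close> meeting \<open>E - F\<close> in as many elements as possible.\<close>

lemma rk_dual_add_nullity:
  assumes "F \<subseteq> E"
  shows "rk (dual E \<I>) F + nullity \<I> (E - F) = nullity \<I> E"
proof -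
  have fin: "finite F" using assms by (rule finite_subset_ground)
  have split: "card (F - B) + rk \<I> E = card F + card (B \<inter> (E - F))" if "B \<in> bases \<I>" for B
  proof -
    have "B = (B \<inter> F) \<union> (B \<inter> (E - F))" using bases_subset_ground[OF that] by blast
    then have "card B = card (B \<inter> F) + card (B \<inter> (E - F))"
      using card_Un_disjoint[of "B \<inter> F" "B \<inter> (E - F)"] fin finite_ground by auto
    then show ?thesis using card_Diff_plus_Int[OF assms, of B] card_bases[OF that] by simp
  qed
  have "rk (dual E \<I>) F = card F + rk \<I> (E - F) - rk \<I> E"
    unfolding rk_def[of "dual E \<I>"]
  proof (rule Max_eqI)
    show "finite (card ` {X \<in> dual E \<I>. X \<subseteq> F})" using fin by simp
  next
    fix y assume "y \<in> card ` {X \<in> dual E \<I>. X \<subseteq> F}"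
    then obtain X B where X: "y = card X" "X \<subseteq> F" "B \<in> bases \<I>" "X \<inter> B = {}"
      by (auto simp: dual_def)
    have "y \<le> card (F - B)" unfolding X(1) using X fin by (intro card_mono) auto
    moreover have "card (B \<inter> (E - F)) \<le> rk \<I> (E - F)" by (intro rk_ge indep_Int_basis X) auto
    ultimately show "y \<le> card F + rk \<I> (E - F) - rk \<I> E" using split[OF X(3)] by simp
  next
    \<comment> \<open>A constant chain of length one yields the basis for which \<open>F - B\<close>
      attains the maximum.\<close>
    obtain B where B: "B \<in> bases \<I>" "card (B \<inter> (E - F)) = rk \<I> (E - F)"
      using chain_basis[of "\<lambda>_. E - F" 1] by (auto simp: antimono_def)
    have "F - B \<in> {X \<in> dual E \<I>. X \<subseteq> F}" using B(1) assms by (auto simp: dual_def)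
    moreover have "card (F - B) = card F + rk \<I> (E - F) - rk \<I> E" using split[OF B(1)] B(2) by simp
    ultimately show "card F + rk \<I> (E - F) - rk \<I> E \<in> card ` {X \<in> dual E \<I>. X \<subseteq> F}"
      by (metis image_eqI)
  qed
  \<comment> \<open>This makes the truncated subtraction in the rank formula exact.\<close>
  moreover have "rk \<I> E \<le> card F + rk \<I> (E - F)"
  proof -
    obtain B where B: "B \<in> bases \<I>" using basis_superset[OF indep_empty] by blast
    have "card (B \<inter> (E - F)) \<le> rk \<I> (E - F)" by (intro rk_ge indep_Int_basis B) auto
    then show ?thesis using split[OF B] by simp
  qed
  moreover have "card F + card (E - F) = card E"
    using assms finite_ground by (simp add: card_Diff_subset card_mono fin)
  ultimately show ?thesis
    using nullity_add_rk[of "E - F"] nullity_add_rk[of E] by simp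
qed

text \<open>Subtract the additive formula for \<open>F\<close> from the one for \<open>E\<close>; in
  the latter the complement is empty and has nullity 0.\<close>

lemma crk_dual:
  assumes "F \<subseteq> E"
  shows "crk E (dual E \<I>) F = nullity \<I> (E - F)"
  using rk_dual_add_nullity[OF assms] rk_dual_add_nullity[of E] nullity_empty
  by (simp add: crk_def)

text \<open>The dual rank of a set and the nullity of its complement have a constant sum, so one
  rises exactly when the other falls.\<close>

lemma flats_dual_iff:
  "F \<in> flats E (dual E \<I>) \<longleftrightarrow>
     F \<subseteq> E \<and> (\<forall>e\<in>E - F. nullity \<I> (E - F - {e}) < nullity \<I> (E - F))"
proof -
  have "rk (dual E \<I>) F < rk (dual E \<I>) (insert e F) \<longleftrightarrow> nullity \<I> (E - F - {e}) < nullity \<I> (E - F)"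
    if "F \<subseteq> E" "e \<in> E - F" for e
  proof -
    have "E - insert e F = E - F - {e}" by blast
    then show ?thesis
      using rk_dual_add_nullity[OF that(1)] rk_dual_add_nullity[of "insert e F"] that by auto
  qed
  then show ?thesis by (auto simp: flats_def)
qed

section \<open>Circuits of the elongations versus flats of the dual\<close>

lemma elongation_iff: "A \<in> elongation E \<I> i \<longleftrightarrow> A \<subseteq> E \<and> nullity \<I> A < i"
  using nullity_add_rk[of A] by (auto simp: elongation_def)

lemma circuits_elongation_iff:
  "C \<in> circuits E (elongation E \<I> i) \<longleftrightarrow>
     C \<subseteq> E \<and> i \<le> nullity \<I> C \<and> (\<forall>D. D \<subset> C \<longrightarrow> nullity \<I> D < i)"
  by (auto simp: circuits_def elongation_iff)

text \<open>An inclusion-minimal subset of \<open>A\<close> with nullity at least \<open>i\<close>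
  is such a circuit.\<close>

lemma circuit_elongation_subset:
  assumes "A \<subseteq> E" "i \<le> nullity \<I> A"
  obtains C where "C \<in> circuits E (elongation E \<I> i)" "C \<subseteq> A"
proof -
  have fin: "finite {D. D \<subseteq> A \<and> i \<le> nullity \<I> D}"
    using finite_subset_ground[OF assms(1)] by (auto intro: finite_subset[of _ "Pow A"])
  obtain C where C: "C \<subseteq> A" "i \<le> nullity \<I> C"
    and min: "\<forall>D\<in>{D. D \<subseteq> A \<and> i \<le> nullity \<I> D}. D \<subseteq> C \<longrightarrow> C = D"
    using finite_has_minimal2[OF fin, of A] assms by auto
  have "nullity \<I> D < i" if "D \<subset> C" for D
  proof (rule ccontr)
    assume "\<not> nullity \<I> D < i"
    then have "D \<in> {D. D \<subseteq> A \<and> i \<le> nullity \<I> D}" using that C(1) by auto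
    then show False using min that by blast
  qed
  then have "C \<in> circuits E (elongation E \<I> i)"
    using C assms(1) by (auto simp: circuits_elongation_iff)
  then show ?thesis using that C(1) by blast
qed

text \<open>Removing an element of a circuit brings the nullity below \<open>i\<close>, and it drops
  by at most one, so it was exactly \<open>i\<close>. Conversely, every proper subset lies in some
  \<open>C - {e}\<close>, and nullity is monotone.\<close>

lemma flats_dual_iff_circuits_elongation:
  assumes "C \<subseteq> E" "0 < i"
  shows "C \<in> circuits E (elongation E \<I> i) \<longleftrightarrow>
           E - C \<in> flats E (dual E \<I>) \<and> crk E (dual E \<I>) (E - C) = i"
proof -
  have C: "E - (E - C) = C" using assms by blast
  have crk: "crk E (dual E \<I>) (E - C) = nullity \<I> C" using crk_dual[of "E - C"] C by simp
  have flat: "E - C \<in> flats E (dual E \<I>) \<longleftrightarrow> (\<forall>e\<in>C. nullity \<I> (C - {e}) < nullity \<I> C)"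
    using flats_dual_iff[of "E - C"] C by simp
  show ?thesis unfolding crk flat
  proof
    assume "C \<in> circuits E (elongation E \<I> i)"
    then have c: "i \<le> nullity \<I> C" "\<And>D. D \<subset> C \<Longrightarrow> nullity \<I> D < i"
      by (auto simp: circuits_elongation_iff)
    have small: "nullity \<I> (C - {e}) < i" if "e \<in> C" for e using c(2)[of "C - {e}"] that by blast
    \<comment> \<open>Positivity of \<open>i\<close> rules out the empty set and so provides an
      element to remove.\<close>
    have "C \<noteq> {}" using c(1) assms(2) nullity_empty by auto
    then obtain e where e: "e \<in> C" by blast
    have "nullity \<I> C = i"
      using nullity_insert_le[of e "C - {e}"] small[OF e] c(1) e assms(1) by (simp add: insert_absorb)
    then show "(\<forall>e\<in>C. nullity \<I> (C - {e}) < nullity \<I> C) \<and> nullity \<I> C = i" using small by simp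
  next
    assume f: "(\<forall>e\<in>C. nullity \<I> (C - {e}) < nullity \<I> C) \<and> nullity \<I> C = i"
    have "nullity \<I> D < i" if D: "D \<subset> C" for D
    proof -
      obtain e where e: "e \<in> C" "e \<notin> D" using D by blast
      then have "nullity \<I> D \<le> nullity \<I> (C - {e})"
        using D assms(1) by (intro nullity_mono) auto
      also have "\<dots> < i" using f e(1) by blast
      finally show ?thesis .
    qed
    then show "C \<in> circuits E (elongation E \<I> i)" using f assms(1) by (simp add: circuits_elongation_iff)
  qed
qed

text \<open>Taking complements matches the two index sets. The function \<open>g\<close> is
  arbitrary so that it can be instantiated with the monomials of the theorem.\<close>

lemma circuits_elongation_eq_flats_dual:
  "{g C i | C i. i \<in> {1..nullity \<I> E} \<and> C \<in> circuits E (elongation E \<I> i)} =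
   {g (E - F) (crk E (dual E \<I>) F) | F. F \<in> flats E (dual E \<I>) \<and> F \<noteq> E}" (is "?L = ?R")
proof (intro equalityI subsetI)
  fix x assume "x \<in> ?L"
  then obtain C i where x: "x = g C i" and i: "0 < i" and C: "C \<in> circuits E (elongation E \<I> i)"
    by auto
  have CE: "C \<subseteq> E" and "i \<le> nullity \<I> C" using C by (auto simp: circuits_elongation_iff)
  then have "C \<noteq> {}" using i nullity_empty by auto
  then have "E - C \<noteq> E" using CE by blast
  moreover have "E - (E - C) = C" using CE by blast
  ultimately show "x \<in> ?R"
    using flats_dual_iff_circuits_elongation[OF CE i] C x by (auto intro!: exI[of _ "E - C"])
next
  fix x assume "x \<in> ?R"
  then obtain F where x: "x = g (E - F) (crk E (dual E \<I>) F)"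
    and F: "F \<in> flats E (dual E \<I>)" "F \<noteq> E" by auto
  have FE: "F \<subseteq> E" using F by (simp add: flats_def)
  have C: "E - (E - F) = F" using FE by blast
  have crk: "crk E (dual E \<I>) F = nullity \<I> (E - F)" by (rule crk_dual[OF FE])
  \<comment> \<open>Removing \<open>e\<close> strictly lowers the nullity of \<open>E - F\<close>,
    so the resulting index is at least 1.\<close>
  obtain e where "e \<in> E - F" using FE F(2) by blast
  then have pos: "0 < nullity \<I> (E - F)" using F(1) flats_dual_iff by fastforce
  have "E - F \<in> circuits E (elongation E \<I> (crk E (dual E \<I>) F))"
    using flats_dual_iff_circuits_elongation[of "E - F" "crk E (dual E \<I>) F"] F(1) C crk pos by simp
  moreover have "nullity \<I> (E - F) \<le> nullity \<I> E" by (rule nullity_mono) auto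
  ultimately show "x \<in> ?L" using x pos crk by (auto intro!: exI[of _ "E - F"])
qed

end

section \<open>Symbolic powers as monomial ideals\<close>

text \<open>The degree of the monomial in the variables from \<open>A\<close>; by
  \<open>var_ideal_power\<close> it decides membership in powers of the ideal of these
  variables.\<close>

abbreviation weight :: "'e set \<Rightarrow> ('e \<Rightarrow>\<^sub>0 nat) \<Rightarrow> nat" where
  "weight A m \<equiv> \<Sum>e\<in>A. Poly_Mapping.lookup m e"

lemma weight_add: "weight A (u + v) = weight A u + weight A v"
  by (simp add: lookup_add sum.distrib)

lemma weight_indicator:
  assumes "finite A" "finite U"
  shows "weight A (\<Sum>u\<in>U. Poly_Mapping.single u 1) = card (U \<inter> A)"
  using assms lookup_sum_single[OF assms(2)]
  by (simp add: sum.If_cases Int_commute del: One_nat_def)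

lemma mpoly_ring_simps [simp]:
  "x \<oplus>\<^bsub>mpoly_ring E\<^esub> y = x + y" "x \<otimes>\<^bsub>mpoly_ring E\<^esub> y = x * y"
  "\<zero>\<^bsub>mpoly_ring E\<^esub> = 0" "\<one>\<^bsub>mpoly_ring E\<^esub> = 1"
  by (simp_all add: mpoly_ring_def)

lemma zero_carrier [simp]: "0 \<in> carrier (mpoly_ring E)"
  and one_carrier [simp]: "1 \<in> carrier (mpoly_ring E)"
  by (simp_all add: mpoly_ring_def)

lemma single_carrier: "Poly_Mapping.keys m \<subseteq> E \<Longrightarrow> Poly_Mapping.single m c \<in> carrier (mpoly_ring E)"
  by (simp add: mpoly_ring_def)

lemma a_inv_mpoly_ring:
  assumes "a \<in> carrier (mpoly_ring E)"
  shows "\<ominus>\<^bsub>mpoly_ring E\<^esub> a = - (a :: ('e, 'l::field) mpoly)"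
proof -
  interpret S: cring "mpoly_ring E :: ('e, 'l) mpoly ring" by (rule mpoly_ring_cring)
  show ?thesis
    by (rule S.minus_equality) (use assms in \<open>auto simp: mpoly_ring_def keys_uminus\<close>)
qed

text \<open>The case of single terms concerns only terms of the given \<open>p\<close>, so known
  facts about the exponents of \<open>p\<close> can be used there.\<close>

lemma mpoly_single_induct [case_names zero single add]:
  fixes p :: "('e, 'l::field) mpoly"
  assumes "P 0"
    and "\<And>m. m \<in> Poly_Mapping.keys p \<Longrightarrow> P (Poly_Mapping.single m (Poly_Mapping.lookup p m))"
    and "\<And>a b. P a \<Longrightarrow> P b \<Longrightarrow> P (a + b)"
  shows "P p"
proof -
  have "P (\<Sum>m\<in>K. Poly_Mapping.single m (Poly_Mapping.lookup p m))"
    if "finite K" "K \<subseteq> Poly_Mapping.keys p" for K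
    using that by (induction K) (auto intro: assms)
  then show ?thesis using mpoly_sum_singles[of p] by (metis finite_keys order_refl)
qed

text \<open>Every exponent of a product \<open>x * a\<close> is a sum \<open>u + v\<close> with
  \<open>v\<close> an exponent of \<open>a\<close>, so a property stable under adding exponents
  survives multiplication.\<close>

lemma monomial_ideal:
  assumes "\<And>u v. Q v \<Longrightarrow> Q (u + v)"
  shows "ideal {p \<in> carrier (mpoly_ring E). \<forall>m\<in>Poly_Mapping.keys p. Q m}
           (mpoly_ring E :: ('e, 'l::field) mpoly ring)" (is "ideal ?J ?S")
proof -
  interpret S: cring ?S by (rule mpoly_ring_cring)
  have l: "x * a \<in> ?J" if "a \<in> ?J" "x \<in> carrier ?S" for a x
  proof -
    have "Q m" if "m \<in> Poly_Mapping.keys (x * a)" for m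
      using subsetD[OF keys_mult that] \<open>a \<in> ?J\<close> assms by blast
    then show ?thesis using that S.m_closed[of x a] by simp
  qed
  show ?thesis
  proof (rule idealI)
    show "subgroup ?J (add_monoid ?S)"
    proof (rule S.add.subgroupI)
      show "?J \<noteq> {}" using S.zero_closed by fastforce
      show "\<ominus>\<^bsub>?S\<^esub> a \<in> ?J" if "a \<in> ?J" for a
        using that S.a_inv_closed[of a] by (simp add: a_inv_mpoly_ring keys_uminus)
      show "a \<oplus>\<^bsub>?S\<^esub> b \<in> ?J" if "a \<in> ?J" "b \<in> ?J" for a b
        using that keys_add[of a b] S.a_closed[of a b] by auto
    qed auto
    show "ring ?S" by (rule S.ring_axioms)
    show "x \<otimes>\<^bsub>?S\<^esub> a \<in> ?J" if "a \<in> ?J" "x \<in> carrier ?S" for a x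
      using l[OF that] by simp
    show "a \<otimes>\<^bsub>?S\<^esub> x \<in> ?J" if "a \<in> ?J" "x \<in> carrier ?S" for a x
      using l[OF that] by (simp add: mult.commute)
  qed
qed

text \<open>Induction on \<open>s\<close>: weights add under multiplication, and from a term of
  weight at least \<open>Suc s\<close> one variable of \<open>U\<close> can be split off.\<close>

lemma var_ideal_power:
  assumes "finite E" "U \<subseteq> E"
  shows "var_ideal E U [^]\<^bsub>ideals_set (mpoly_ring E)\<^esub> (s::nat) =
           {p \<in> carrier (mpoly_ring E :: ('e, 'l::field) mpoly ring).
              \<forall>m\<in>Poly_Mapping.keys p. s \<le> weight U m}"
proof -
  let ?S = "mpoly_ring E :: ('e, 'l) mpoly ring"
  interpret S: cring ?S by (rule mpoly_ring_cring)
  interpret M: comm_monoid "ideals_set ?S" by (rule S.ideals_set_is_comm_monoid)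
  define W where "W s = {p \<in> carrier ?S. \<forall>m\<in>Poly_Mapping.keys p. s \<le> weight U m}" for s
  have W: "ideal (W s) ?S" for s
    unfolding W_def by (rule monomial_ideal) (simp add: weight_add)
  have finU: "finite U" using assms by (rule rev_finite_subset)
  have V: "var_ideal E U = W 1"
  proof -
    have x: "xvar ` U = (xset ` (\<lambda>u. {u}) ` U :: ('e, 'l) mpoly set)"
      by (simp add: image_image xset_def)
    \<comment> \<open>Positive weight means that a variable of \<open>U\<close> occurs, which is how
      \<open>squarefree_ideal_eq\<close> describes the ideal generated by singletons.\<close>
    have "(\<exists>A\<in>(\<lambda>u. {u}) ` U. A \<subseteq> Poly_Mapping.keys m) \<longleftrightarrow> 1 \<le> weight U m" for m
      using finU by (auto simp: in_keys_iff Suc_le_eq sum_nonneg_eq_0_iff neq0_conv[symmetric] simp del: neq0_conv)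
    then show ?thesis
      unfolding var_ideal_def x W_def
      by (subst squarefree_ideal_eq[OF assms(1)]) (use assms(2) in auto)
  qed
  have "var_ideal E U [^]\<^bsub>ideals_set ?S\<^esub> s = W s"
  proof (induction s)
    case 0
    then show ?case by (simp add: W_def ideals_set_def)
  next
    case (Suc s)
    have "ideal_prod ?S (W s) (W 1) = W (Suc s)"
    proof (intro equalityI subsetI)
      fix p assume "p \<in> ideal_prod ?S (W s) (W 1)"
      then show "p \<in> W (Suc s)"
      proof (induction rule: ideal_prod.induct)
        case (prod i j)
        have "Suc s \<le> weight U m" if m: "m \<in> Poly_Mapping.keys (i * j)" for m
        proof -
          obtain u v where "m = u + v" "u \<in> Poly_Mapping.keys i" "v \<in> Poly_Mapping.keys j"
            using subsetD[OF keys_mult m] by blast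
          then show ?thesis using prod by (fastforce simp: W_def weight_add)
        qed
        then show ?case using prod S.m_closed[of i j] by (simp add: W_def)
      next
        case (sum a b)
        then show ?case
          using additive_subgroup.a_closed[OF ideal.axioms(1)[OF W]] by blast
      qed
    next
      fix p assume p: "p \<in> W (Suc s)"
      have id: "ideal (ideal_prod ?S (W s) (W 1)) ?S" by (intro S.ideal_prod_is_ideal W)
      show "p \<in> ideal_prod ?S (W s) (W 1)"
      proof (induction p rule: mpoly_single_induct)
        case zero
        then show ?case using additive_subgroup.zero_closed[OF ideal.axioms(1)[OF id]] by simp
      next
        case (add a b)
        then show ?case using ideal_prod.sum[of a ?S "W s" "W 1" b] by simp
      next
        case (single m)
        have mE: "Poly_Mapping.keys m \<subseteq> E" and wm: "Suc s \<le> weight U m"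
          using p single by (auto simp: W_def mpoly_ring_def)
        have "weight U m \<noteq> 0" using wm by simp
        then obtain u where u: "u \<in> U" "u \<in> Poly_Mapping.keys m"
          by (metis in_keys_iff sum.neutral)
        \<comment> \<open>Division by one occurrence of \<open>u\<close>; the sum over a singleton
          matches \<open>single_split\<close>.\<close>
        let ?m = "m - (\<Sum>v\<in>{u}. Poly_Mapping.single v 1)"
        let ?c = "Poly_Mapping.lookup p m"
        have eq: "m = ?m + Poly_Mapping.single u 1"
          using u(2) by (intro poly_mapping_eqI)
            (auto simp: lookup_add lookup_minus lookup_single when_def in_keys_iff)
        have wu: "weight U (Poly_Mapping.single u 1) = 1"
          using u(1) finU by (simp add: lookup_single when_def)
        have "weight U m = weight U ?m + 1"
          by (subst eq) (simp only: weight_add wu)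
        then have s: "s \<le> weight U ?m" using wm by simp
        have "Poly_Mapping.keys ?m \<subseteq> Poly_Mapping.keys m"
          by (auto simp: in_keys_iff lookup_minus)
        then have "Poly_Mapping.single ?m ?c \<in> W s"
          using mE s by (simp add: W_def single_carrier)
        moreover have "xset {u} \<in> W 1"
          using u(1) assms(2) wu
          by (auto simp: W_def xset_def xvar_def intro!: single_carrier)
        ultimately have "Poly_Mapping.single ?m ?c \<otimes>\<^bsub>?S\<^esub> xset {u} \<in> ideal_prod ?S (W s) (W 1)"
          by (rule ideal_prod.prod)
        then show ?case using single_split[of "{u}" m ?c] u(2) by simp
      qed
    qed
    then show ?case using Suc.IH V by (simp add: ideals_set_def)
  qed
  then show ?thesis by (simp add: W_def)
qed

section \<open>Symbolic powers in terms of complements of bases\<close>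

context matroid
begin

text \<open>Bases of the dual are complements of bases, so the intersection of powers becomes a
  simultaneous weight condition. A basis exists, which keeps the intersection inside the
  carrier.\<close>

lemma symbolic_power_eq:
  "symbolic_power E \<I> s = {p \<in> carrier (mpoly_ring E :: ('e, 'l::field) mpoly ring).
     \<forall>m\<in>Poly_Mapping.keys p. \<forall>B\<in>bases \<I>. s \<le> weight (E - B) m}"
proof -
  have "bases \<I> \<noteq> {}" using basis_superset[OF indep_empty] by blast
  then show ?thesis
    unfolding symbolic_power_def bases_dual image_image
    by (auto simp: var_ideal_power[OF finite_ground])
qed

lemma symbolic_power_ideal:
  "ideal (symbolic_power E \<I> s) (mpoly_ring E :: ('e, 'l::field) mpoly ring)"
  unfolding symbolic_power_eq by (rule monomial_ideal) (simp add: weight_add trans_le_add2)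

lemma symbolic_power_0:
  "symbolic_power E \<I> 0 = carrier (mpoly_ring E :: ('e, 'l::field) mpoly ring)"
  by (simp add: symbolic_power_eq)

lemma symbolic_power_mult:
  assumes "p \<in> symbolic_power E \<I> i" "q \<in> symbolic_power E \<I> j"
  shows "p * q \<in> (symbolic_power E \<I> (i + j) :: ('e, 'l::field) mpoly set)"
proof -
  interpret S: cring "mpoly_ring E :: ('e, 'l) mpoly ring" by (rule mpoly_ring_cring)
  have "i + j \<le> weight (E - B) m" if m: "m \<in> Poly_Mapping.keys (p * q)" and B: "B \<in> bases \<I>" for m B
  proof -
    obtain u v where "m = u + v" "u \<in> Poly_Mapping.keys p" "v \<in> Poly_Mapping.keys q"
      using subsetD[OF keys_mult m] by blast
    then show ?thesis
      using assms B by (auto simp: symbolic_power_eq weight_add intro!: add_mono)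
  qed
  then show ?thesis using assms S.m_closed[of p q] by (simp add: symbolic_power_eq)
qed

lemma xset_carrier: "A \<subseteq> E \<Longrightarrow> xset A \<in> carrier (mpoly_ring E :: ('e, 'l::field) mpoly ring)"
  using lookup_sum_single[OF finite_subset_ground, of A]
  by (auto simp: xset_eq_single finite_subset_ground in_keys_iff intro!: single_carrier
      simp del: One_nat_def split: if_splits)

text \<open>On \<open>E - B\<close> the exponent of \<open>xset A\<close> has weight
  \<open>card (A - B)\<close>, which is at least the nullity of \<open>A\<close>.\<close>

lemma xset_symbolic_power:
  assumes "A \<subseteq> E" "i \<le> nullity \<I> A"
  shows "xset A \<in> (symbolic_power E \<I> i :: ('e, 'l::field) mpoly set)"
proof -
  have fin: "finite A" using assms(1) by (rule finite_subset_ground)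
  have "i \<le> weight (E - B) (\<Sum>u\<in>A. Poly_Mapping.single u 1)" if "B \<in> bases \<I>" for B
  proof -
    have "A \<inter> (E - B) = A - B" using assms(1) by blast
    then show ?thesis
      using nullity_le_card_Diff_basis[OF assms(1) that] assms(2) weight_indicator[OF _ fin, of "E - B"]
        finite_ground by simp
  qed
  then show ?thesis
    using xset_carrier[OF assms(1), where 'l = 'l] by (simp add: symbolic_power_eq xset_eq_single[OF fin])
qed

section \<open>The symbolic Rees algebra\<close>

text \<open>Coefficient \<open>n\<close> of a product is a finite sum of products of coefficients in
  degrees \<open>i\<close> and \<open>n - i\<close>, each in the \<open>n\<close>-th symbolic power.
  This yields the easy inclusion of the theorem.\<close>

lemma symbolic_rees_subring:
  "subring (symbolic_rees E \<I>) (UP (mpoly_ring E :: ('e, 'l::field) mpoly ring))"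
proof -
  let ?S = "mpoly_ring E :: ('e, 'l) mpoly ring"
  interpret S: UP_cring ?S "UP ?S"
    by (simp add: UP_cring_def mpoly_ring_cring)
  have J: "additive_subgroup (symbolic_power E \<I> i) ?S" for i
    by (rule ideal.axioms(1)[OF symbolic_power_ideal])
  have sum: "(\<Oplus>\<^bsub>?S\<^esub>i\<in>A. f i) \<in> symbolic_power E \<I> n"
    if "finite A" "\<And>i. i \<in> A \<Longrightarrow> f i \<in> symbolic_power E \<I> n" for A :: "nat set" and f n
    using that
  proof (induction A)
    case empty
    then show ?case using additive_subgroup.zero_closed[OF J] by simp
  next
    case (insert x A)
    have "f x \<in> carrier ?S" "f \<in> A \<rightarrow> carrier ?S"
      using insert.prems additive_subgroup.a_Hcarr[OF J] by blast+
    then show ?case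
      using insert additive_subgroup.a_closed[OF J, of "f x"] by (simp del: mpoly_ring_simps)
  qed
  show ?thesis
  proof (rule S.P.subringI)
    show "\<one>\<^bsub>UP ?S\<^esub> \<in> symbolic_rees E \<I>"
      using additive_subgroup.zero_closed[OF J]
      by (simp add: symbolic_rees_def symbolic_power_0)
    show "\<ominus>\<^bsub>UP ?S\<^esub> h \<in> symbolic_rees E \<I>" if "h \<in> symbolic_rees E \<I>" for h
      using that additive_subgroup.a_inv_closed[OF J] by (simp add: symbolic_rees_def)
    show "h \<oplus>\<^bsub>UP ?S\<^esub> g \<in> symbolic_rees E \<I>" if "h \<in> symbolic_rees E \<I>" "g \<in> symbolic_rees E \<I>" for h g
      using that additive_subgroup.a_closed[OF J]
      by (simp add: symbolic_rees_def del: mpoly_ring_simps)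
    show "h \<otimes>\<^bsub>UP ?S\<^esub> g \<in> symbolic_rees E \<I>" if "h \<in> symbolic_rees E \<I>" "g \<in> symbolic_rees E \<I>" for h g
    proof -
      have "coeff (UP ?S) h i * coeff (UP ?S) g (n - i) \<in> symbolic_power E \<I> n" if "i \<le> n" for i n
        using symbolic_power_mult[of "coeff (UP ?S) h i" i "coeff (UP ?S) g (n - i)" "n - i"] that
          \<open>h \<in> symbolic_rees E \<I>\<close> \<open>g \<in> symbolic_rees E \<I>\<close> by (simp add: symbolic_rees_def)
      then show ?thesis using that by (auto simp: symbolic_rees_def intro!: sum)
    qed
  qed (auto simp: symbolic_rees_def)
qed

lemma monom_symbolic_rees:
  assumes "p \<in> symbolic_power E \<I> i"
  shows "monom (UP (mpoly_ring E)) p i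
           \<in> (symbolic_rees E \<I> :: (nat \<Rightarrow> ('e, 'l::field) mpoly) set)"
proof -
  let ?S = "mpoly_ring E :: ('e, 'l) mpoly ring"
  interpret S: UP_cring ?S "UP ?S"
    by (simp add: UP_cring_def mpoly_ring_cring)
  have "p \<in> carrier ?S" using assms by (simp add: symbolic_power_eq)
  moreover have "0 \<in> symbolic_power E \<I> j" for j by (simp add: symbolic_power_eq)
  ultimately show ?thesis using assms by (auto simp: symbolic_rees_def)
qed

section \<open>Decomposing a monomial into its level sets\<close>

text \<open>For a basis optimal on all level sets at once, counting the weight on its complement
  level by level gives exactly the sum of nullities.\<close>

lemma le_sum_nullity_levels:
  assumes m: "Poly_Mapping.keys m \<subseteq> E" "\<And>e. e \<in> E \<Longrightarrow> Poly_Mapping.lookup m e \<le> N"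
    and s: "\<And>B. B \<in> bases \<I> \<Longrightarrow> s \<le> weight (E - B) m"
  shows "s \<le> (\<Sum>t<N. nullity \<I> {e \<in> E. t < Poly_Mapping.lookup m e})"
proof -
  define L where "L t = {e \<in> E. t < Poly_Mapping.lookup m e}" for t
  have LE: "L t \<subseteq> E" for t by (auto simp: L_def)
  have "antimono L" by (auto simp: L_def antimono_def)
  then obtain B where B: "B \<in> bases \<I>" "\<And>t. t < N \<Longrightarrow> card (B \<inter> L t) = rk \<I> (L t)"
    using chain_basis[of L N] by blast
  \<comment> \<open>An exponent equals the number of levels containing its variable;
    \<open>N\<close> bounds all exponents, so no level is lost.\<close>
  have level: "Poly_Mapping.lookup m e = (\<Sum>t<N. if e \<in> L t then 1 else 0)" if "e \<in> E" for e
  proof -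
    have "{..<N} \<inter> {t. t < Poly_Mapping.lookup m e} = {..<Poly_Mapping.lookup m e}"
      using m(2)[OF that] by auto
    then show ?thesis using that by (simp add: L_def sum.If_cases)
  qed
  have "weight (E - B) m = (\<Sum>e\<in>E - B. \<Sum>t<N. if e \<in> L t then 1 else 0)"
    by (intro sum.cong) (auto simp: level)
  also have "\<dots> = (\<Sum>t<N. \<Sum>e\<in>E - B. if e \<in> L t then 1 else 0)" by (rule sum.swap)
  also have "\<dots> = (\<Sum>t<N. nullity \<I> (L t))"
  proof (rule sum.cong[OF refl])
    fix t assume t: "t \<in> {..<N}"
    have "(E - B) \<inter> L t = L t - B" using LE by auto
    then have "(\<Sum>e\<in>E - B. if e \<in> L t then 1 else 0) = card (L t - B)"
      using finite_ground by (simp add: sum.If_cases)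
    also have "\<dots> = nullity \<I> (L t)"
      using card_Diff_plus_Int[OF LE, of t B] nullity_add_rk[OF LE, of t] B(2) t by simp
    finally show "(\<Sum>e\<in>E - B. if e \<in> L t then 1 else 0) = nullity \<I> (L t)" .
  qed
  finally show ?thesis using s[OF B(1)] by (simp add: L_def)
qed

text \<open>Each variable occurs once in the factor of every level below its exponent. The
  coefficient is split off as a constant.\<close>

lemma single_eq_prod_levels:
  assumes "Poly_Mapping.keys m \<subseteq> E" "\<And>e. e \<in> E \<Longrightarrow> Poly_Mapping.lookup m e \<le> N"
  shows "Poly_Mapping.single m (c::'l::field) =
    Poly_Mapping.single 0 c * (\<Prod>t<N. xset {e \<in> E. t < Poly_Mapping.lookup m e})"
proof -
  define L where "L t = {e \<in> E. t < Poly_Mapping.lookup m e}" for t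
  have finL: "finite (L t)" for t using finite_ground by (simp add: L_def)
  have "Poly_Mapping.lookup m e = (\<Sum>t<N. if e \<in> L t then 1 else 0)" for e
  proof (cases "e \<in> E")
    case True
    have "{..<N} \<inter> {t. t < Poly_Mapping.lookup m e} = {..<Poly_Mapping.lookup m e}"
      using assms(2)[OF True] by auto
    then show ?thesis using True by (simp add: L_def sum.If_cases)
  next
    case False
    then show ?thesis using assms(1) by (auto simp: L_def in_keys_iff)
  qed
  then have m: "m = (\<Sum>t<N. \<Sum>u\<in>L t. Poly_Mapping.single u 1)"
    by (intro poly_mapping_eqI) (subst lookup_sum, simp add: lookup_sum_single[OF finL] del: One_nat_def)
  have prod: "(\<Prod>t<N. xset (L t)) = Poly_Mapping.single (\<Sum>t<N. \<Sum>u\<in>L t. Poly_Mapping.single u 1) (1::'l)" for N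
    by (induction N) (simp_all add: xset_eq_single[OF finL] mult_single add.commute)
  show ?thesis
    unfolding L_def[symmetric] prod m[symmetric] by (simp add: mult_single)
qed

section \<open>Generators of the symbolic Rees algebra\<close>

lemma symbolic_rees_eq_generated:
  "(symbolic_rees E \<I> :: (nat \<Rightarrow> ('e, 'l::field) mpoly) set) =
     generated_algebra (mpoly_ring E)
       {monom (UP (mpoly_ring E)) (xset C) i | C i.
          i \<in> {1..nullity \<I> E} \<and> C \<in> circuits E (elongation E \<I> i)}"
proof -
  let ?S = "mpoly_ring E :: ('e, 'l) mpoly ring"
  interpret S: UP_cring ?S "UP ?S"
    by (simp add: UP_cring_def mpoly_ring_cring)
  define H where "H = (\<lambda>a. monom (UP ?S) a 0) ` carrier ?S \<union>
    {monom (UP ?S) (xset C) i | C i. i \<in> {1..nullity \<I> E} \<and> C \<in> circuits E (elongation E \<I> i)}"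
  define A where "A = generate_ring (UP ?S) H"
  have H: "H \<subseteq> symbolic_rees E \<I>"
    by (auto simp: H_def circuits_elongation_iff symbolic_power_0
        intro!: monom_symbolic_rees xset_symbolic_power)
  have Hc: "H \<subseteq> carrier (UP ?S)" using H by (auto simp: symbolic_rees_def)
  have sub: "subring A (UP ?S)" unfolding A_def by (rule S.P.generate_ring_is_subring[OF Hc])
  have const: "monom (UP ?S) a 0 \<in> A" if "a \<in> carrier ?S" for a
    unfolding A_def H_def using that by (blast intro: generate_ring.incl)
  have times: "monom (UP ?S) (a * b) (i + j) \<in> A"
    if "a \<in> carrier ?S" "b \<in> carrier ?S" "monom (UP ?S) a i \<in> A" "monom (UP ?S) b j \<in> A" for a b i j
    using subringE(6)[OF sub that(3,4)] S.monom_mult[OF that(1,2), of i j] by simp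
  \<comment> \<open>For positive \<open>j\<close>, \<open>L\<close> contains a circuit
    \<open>C\<close> of the \<open>j\<close>-th elongation; the generator of \<open>C\<close>
    carries the whole \<open>T\<close>-degree and \<open>xset (L - C)\<close> is a constant of the
    algebra.\<close>
  have xset: "monom (UP ?S) (xset L) j \<in> A" if L: "L \<subseteq> E" "j \<le> nullity \<I> L" for L j
  proof (cases "j = 0")
    case True
    then show ?thesis using const xset_carrier[OF L(1)] by simp
  next
    case False
    obtain C where C: "C \<in> circuits E (elongation E \<I> j)" "C \<subseteq> L"
      using circuit_elongation_subset[OF L] by blast
    have "j \<le> nullity \<I> E" using L nullity_mono[OF L(1)] by simp
    then have "monom (UP ?S) (xset C) j \<in> A"
      unfolding A_def H_def using C(1) False by (intro generate_ring.incl) auto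
    moreover have "xset L = xset (L - C) * (xset C :: ('e, 'l) mpoly)"
      using C(2) finite_subset_ground[OF L(1)] by (simp add: xset_def prod.subset_diff)
    ultimately show ?thesis
      using times[of "xset (L - C)" "xset C" 0 j] const xset_carrier[of "L - C"] xset_carrier[of C]
        C(2) L(1) by auto
  qed
  have prod: "c * (\<Prod>t<N. xset (L t)) \<in> carrier ?S \<and>
      monom (UP ?S) (c * (\<Prod>t<N. xset (L t))) s \<in> A"
    if "c \<in> carrier ?S" "\<And>t. L t \<subseteq> E" "s \<le> (\<Sum>t<N. nullity \<I> (L t))"
    for c L s and N :: nat
    using that(3)
  proof (induction N arbitrary: s)
    case 0
    then show ?case using const that(1) by simp
  next
    case (Suc N)
    \<comment> \<open>The last factor takes as much of the \<open>T\<close>-degree as its nullity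
      allows; the other levels can absorb the rest.\<close>
    define j where "j = min s (nullity \<I> (L N))"
    have j: "j \<le> nullity \<I> (L N)" "(s - j) + j = s" "s - j \<le> (\<Sum>t<N. nullity \<I> (L t))"
      using Suc.prems by (auto simp: j_def min_def)
    show ?case
      using times[of "c * (\<Prod>t<N. xset (L t))" "xset (L N)" "s - j" j] Suc.IH[OF j(3)]
        xset[OF that(2) j(1)] xset_carrier[OF that(2), where 'l = 'l]
        S.R.m_closed[of "c * (\<Prod>t<N. xset (L t))" "xset (L N)"]
      by (simp add: j(2) mult.assoc)
  qed
  have single_A: "monom (UP ?S) (Poly_Mapping.single m c) s \<in> A"
    if "Poly_Mapping.keys m \<subseteq> E" "\<And>B. B \<in> bases \<I> \<Longrightarrow> s \<le> weight (E - B) m" for m c s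
  proof -
    \<comment> \<open>The total degree serves as a crude bound on all exponents.\<close>
    define N where "N = weight E m"
    have N: "Poly_Mapping.lookup m e \<le> N" if "e \<in> E" for e
      unfolding N_def using that finite_ground by (intro member_le_sum) auto
    have "Poly_Mapping.single m c =
        Poly_Mapping.single 0 c * (\<Prod>t<N. xset {e \<in> E. t < Poly_Mapping.lookup m e})"
      by (intro single_eq_prod_levels that N)
    moreover have "Poly_Mapping.single 0 c \<in> carrier ?S" by (rule single_carrier) simp
    moreover have "s \<le> (\<Sum>t<N. nullity \<I> {e \<in> E. t < Poly_Mapping.lookup m e})"
      by (intro le_sum_nullity_levels that N)
    ultimately show ?thesis
      using prod[of _ "\<lambda>t. {e \<in> E. t < Poly_Mapping.lookup m e}"] by auto
  qed
  have monom: "monom (UP ?S) p s \<in> A" if p: "p \<in> symbolic_power E \<I> s" for p s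
  proof -
    \<comment> \<open>Carrier membership is part of the induction because \<open>S.monom_add\<close>
      requires it of both summands.\<close>
    have "p \<in> carrier ?S \<and> monom (UP ?S) p s \<in> A"
    proof (induction p rule: mpoly_single_induct)
      case zero
      then show ?case using S.R.zero_closed S.monom_zero subringE(2)[OF sub] by simp
    next
      case (single m)
      then show ?case
        using p by (auto simp: symbolic_power_eq mpoly_ring_def intro!: single_A[unfolded mpoly_ring_def])
    next
      case (add a b)
      then show ?case
        using S.R.a_closed[of a b] S.monom_add[of a b s] subringE(7)[OF sub, of "monom (UP ?S) a s" "monom (UP ?S) b s"]
        by simp
    qed
    then show ?thesis ..
  qed
  have "(symbolic_rees E \<I> :: (nat \<Rightarrow> ('e, 'l) mpoly) set) \<subseteq> A"
  proof
    fix p :: "nat \<Rightarrow> ('e, 'l) mpoly"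
    assume p: "p \<in> symbolic_rees E \<I>"
    have sum: "(\<Oplus>\<^bsub>UP ?S\<^esub>i\<in>K. monom (UP ?S) (coeff (UP ?S) p i) i) \<in> A" if "finite K" for K
      using that
    proof (induction K)
      case empty
      then show ?case using subringE(2)[OF sub] by simp
    next
      case (insert i K)
      then show ?case
        using p monom subringE(7)[OF sub] by (simp add: symbolic_rees_def)
    qed
    have "(\<Oplus>\<^bsub>UP ?S\<^esub>i\<in>{..deg ?S p}. monom (UP ?S) (coeff (UP ?S) p i) i) = p"
      using p by (intro S.up_repr) (simp add: symbolic_rees_def)
    then show "p \<in> A" using sum[of "{..deg ?S p}"] by simp
  qed
  moreover have "A \<subseteq> symbolic_rees E \<I>"
    unfolding A_def by (rule S.P.generate_ring_min_subring1[OF Hc symbolic_rees_subring H])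
  ultimately show ?thesis by (auto simp: generated_algebra_def A_def H_def)
qed

end

theorem theorem5p8:
  fixes E :: "'e set" and \<I> :: "'e set set" and k n :: nat
    and S :: "('e, 'l::field) mpoly ring"
  assumes "matroid E \<I>"
    and "card E = n" and "rk \<I> E = k"
    and "0 < k" and "k < n"
    and "S = mpoly_ring E"
  shows "symbolic_rees E \<I> =
           generated_algebra S
             {monom (UP S) (xset C) i | C i. i \<in> {1..n - k} \<and> C \<in> circuits E (elongation E \<I> i)}
       \<and> symbolic_rees E \<I> =
           generated_algebra S
             {monom (UP S) (xset (E - F)) (crk E (dual E \<I>) F) | F. F \<in> flats E (dual E \<I>) \<and> F \<noteq> E}"
proof -
  interpret matroid E \<I> by (rule assms(1))
  \<comment> \<open>The range of \<open>i\<close> in the theorem is thus the one bounded by the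
    nullity of the ground set.\<close>
  have "n - k = nullity \<I> E" using assms(2,3) by (simp add: nullity_def)
  then show ?thesis
    using symbolic_rees_eq_generated[where 'l = 'l]
      circuits_elongation_eq_flats_dual[of "\<lambda>C i. monom (UP S) (xset C) i"]
    unfolding assms(6) by metis
qed

end
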